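(* Let $\Omega$ be a (non-empty) set with $|\Omega|<\infty$ and let $\overline{R}\colon L^\infty\to\mathbb{R}$ be a coherent upper prevision on $L^\infty$. Then there exists a sequence $\vec{\Omega}\colon\mathbb{N}\to\Omega$ such that $$\overline{R}(X)=\sup\left\{E(X)\colon E\in \operatorname{CP}\left(\vec{E}_{\vec{\Omega}}\right)\right\}\qquad \text{for all } X\in L^\infty,$$ where $\vec{E}_{\vec{\Omega}}$ is the sequence of linear functionals on $L^\infty$ given by $\vec{E}_{\vec{\Omega}}(n)(X)=\frac1n\sum_{i=1}^n X(\vec{\Omega}(i))$.
   Context: $L^\infty$ is the vector space of all bounded functions $X\colon\Omega\to\mathbb{R}$ (gambles), with the supremum norm; $(L^\infty)^*$ is its topological dual with the weak* topology. A functional $\overline{R}\colon L^\infty\to\mathbb{R}$ is a coherent upper prevision if for all $X,Y\in L^\infty$: (UP1) $\overline{R}(X)\le \sup_{\omega\in\Omega} X(\omega)$; (UP2) $\overline{R}(\lambda X)=\lambda\overline{R}(X)$ for all $\lambda\in\mathbb{R}^+$; (UP3) $\overline{R}(X+Y)\le\overline{R}(X)+\overline{R}(Y)$. Let $\operatorname{PF}(\Omega)=\{E\in(L^\infty)^*\colon E(X)\ge 0 \text{ whenever } X\ge 0,\ E(\chi_\Omega)=1\}$ (the linear previsions), where $\chi_A$ is the indicator function of $A$; $\operatorname{PF}(\Omega)$ carries the subspace topology of the weak* topology, and $\vec{E}_{\vec{\Omega}}$ is a $\operatorname{PF}(\Omega)$-valued sequence. For a sequence $\vec S\colon\mathbb{N}\to\mathcal{T}$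 in a topological space, $\operatorname{CP}(\vec S)$ is its set of cluster points: $z\in\operatorname{CP}(\vec S)$ iff for every neighbourhood $N$ of $z$ and every $n_0\in\mathbb{N}$ there is $n\ge n_0$ with $\vec S(n)\in N$. *)

theory Defs
  imports "HOL-Probability.Discrete_Topology"
begin

text \<open>
  The possibility space \<open>\<Omega>\<close> is the type \<^typ>\<open>'w\<close>.  Every function on a discrete space is
  continuous, so the bounded continuous functions on \<^typ>\<open>'w discrete\<close> are exactly the bounded
  functions on \<^typ>\<open>'w\<close>; their library norm is the supremum norm.
\<close>

type_synonym 'w gamble = "'w discrete \<Rightarrow>\<^sub>C real"

definition coherent_upper_prevision :: "('w gamble \<Rightarrow> real) \<Rightarrow> bool" where
  "coherent_upper_prevision R \<longleftrightarrow>
     (\<forall>X. R X \<le> (SUP \<omega>. apply_bcontfun X \<omega>)) \<and>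
     (\<forall>c X. c > 0 \<longrightarrow> R (c *\<^sub>R X) = c * R X) \<and>
     (\<forall>X Y. R (X + Y) \<le> R X + R Y)"

definition indicator_gamble :: "'w set \<Rightarrow> 'w gamble" where
  "indicator_gamble A = Bcontfun (\<lambda>\<omega>. indicator A (of_discrete \<omega>))"

lemma apply_indicator_gamble [simp]:
  "apply_bcontfun (indicator_gamble A) \<omega> = indicator A (of_discrete \<omega>)"
proof -
  let ?f = "\<lambda>\<omega>. indicator A (of_discrete \<omega>) :: real"
  have "continuous_on UNIV ?f"
    by (simp add: continuous_on_open_vimage open_discrete)
  moreover have "bounded (range ?f)"
    by (rule boundedI[of _ 1]) (auto simp: indicator_def)
  ultimately have "?f \<in> bcontfun"
    by (simp add: bcontfun_def)
  then show ?thesis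
    by (simp add: indicator_gamble_def Bcontfun_inverse)
qed

definition PF :: "('w gamble \<Rightarrow>\<^sub>L real) set" where
  "PF = {E. (\<forall>X. (\<forall>\<omega>. apply_bcontfun X \<omega> \<ge> 0) \<longrightarrow> blinfun_apply E X \<ge> 0) \<and>
            blinfun_apply E (indicator_gamble UNIV) = 1}"

text \<open>
  The strong operator topology is the topology of pointwise convergence on
  \<^typ>\<open>'a \<Rightarrow>\<^sub>L 'b\<close>; for scalar-valued operators this is the weak* topology.
\<close>

definition weak_star_topology :: "('a::real_normed_vector \<Rightarrow>\<^sub>L real) topology" where
  "weak_star_topology = strong_operator_topology"

definition PF_topology :: "('w gamble \<Rightarrow>\<^sub>L real) topology" where
  "PF_topology = subtopology weak_star_topology PF"

definition neighbourhood_in :: "'a topology \<Rightarrow> 'a \<Rightarrow> 'a set \<Rightarrow> bool" where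
  "neighbourhood_in T z N \<longleftrightarrow> N \<subseteq> topspace T \<and> (\<exists>U. openin T U \<and> z \<in> U \<and> U \<subseteq> N)"

definition CP :: "'a topology \<Rightarrow> (nat \<Rightarrow> 'a) \<Rightarrow> 'a set" where
  "CP T S = {z \<in> topspace T. \<forall>N n0. neighbourhood_in T z N \<longrightarrow> (\<exists>n\<ge>n0. S n \<in> N)}"

text \<open>
  Sequences are indexed from 1.  The term at index 0 is the zero functional, which lies outside
  \<^term>\<open>PF\<close>; being a single term, it does not affect the set of cluster points.
\<close>

definition empirical_prevision :: "(nat \<Rightarrow> 'w) \<Rightarrow> nat \<Rightarrow> ('w gamble \<Rightarrow>\<^sub>L real)" where
  "empirical_prevision s n =
     Blinfun (\<lambda>X. (1 / real n) * (\<Sum>i=1..n. apply_bcontfun X (discrete (s i))))"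

lemma apply_empirical_prevision [simp]:
  "blinfun_apply (empirical_prevision s n) X =
     (1 / real n) * (\<Sum>i=1..n. apply_bcontfun X (discrete (s i)))"
proof -
  have "bounded_linear (\<lambda>X. apply_bcontfun X \<omega> :: real)" for \<omega> :: "'a discrete"
    by (rule bounded_linear_intro[where K = 1]) (auto simp: norm_bounded simp flip: real_norm_def)
  then have "bounded_linear (\<lambda>X. (1 / real n) * (\<Sum>i=1..n. apply_bcontfun X (discrete (s i))))"
    by (intro bounded_linear_const_mult bounded_linear_sum)
  then show ?thesis
    by (simp only: empirical_prevision_def bounded_linear_Blinfun_apply)
qed

lemma empirical_prevision_in_PF:
  assumes "n \<ge> 1"
  shows "empirical_prevision s n \<in> PF"
  using assms
  by (auto simp: PF_def sum_nonneg)

end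

theory Submission
  imports Defs
begin

text \<open>
  By the Hahn--Banach theorem, \<open>R\<close> is the upper envelope of the convex set \<open>M\<close> of probability vectors
  it dominates.  Take a sequence \<open>t\<close> in \<open>M\<close> that repeats each element of a dense sequence in \<open>M\<close> on
  ever longer blocks, so that its running averages, which lie in \<open>M\<close> by convexity, come close to
  every point of \<open>M\<close> infinitely often.  Choosing at each step the outcome that lags most behind
  its target count yields a sequence of outcomes whose counts stay within bounded distance of the
  partial sums of \<open>t\<close>.  Hence its empirical previsions have the same cluster points as the running
  averages of \<open>t\<close>.
\<close>

section \<open>Sublinear functionals\<close>

text \<open>Hahn--Banach in finite dimension: a hyperplane separating the epigraph of
  \<open>p\<close> from the open ray below \<open>(x0, p x0)\<close> is not vertical, so it is the
  graph of an affine function; homogeneity of \<open>p\<close> then removes the constant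
  term.\<close>

lemma sublinear_supporting_functional:
  fixes p :: "'a::euclidean_space \<Rightarrow> real"
  assumes scale: "\<And>c x. c > 0 \<Longrightarrow> p (c *\<^sub>R x) = c * p x"
    and add: "\<And>x y. p (x + y) \<le> p x + p y"
  obtains l where "\<And>x. l \<bullet> x \<le> p x" and "l \<bullet> x0 = p x0"
proof -
  have p0: "p 0 = 0"
    \<comment> \<open>Homogeneity is assumed for positive factors; the factor 0 is handled through
      \<open>p 0 = 2 * p 0\<close>.\<close>
    using scale[of 2 0] by simp
  define S where "S = {x0} \<times> {..<p x0}"
  define T where "T = {z. p (fst z) \<le> snd z}"
  have scale': "p (c *\<^sub>R x) = c * p x" if "c \<ge> 0" for c x
    using that scale[of c x] p0 by (cases "c = 0") auto
  have "convex S"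
    unfolding S_def by (intro convex_Times) auto
  moreover have "convex T"
  proof (rule convexI)
    fix y z :: "'a \<times> real" and u v :: real
    assume *: "y \<in> T" "z \<in> T" "0 \<le> u" "0 \<le> v" "u + v = 1"
    have "p (u *\<^sub>R fst y + v *\<^sub>R fst z) \<le> u * p (fst y) + v * p (fst z)"
      using add[of "u *\<^sub>R fst y" "v *\<^sub>R fst z"] * by (simp add: scale')
    also have "\<dots> \<le> u * snd y + v * snd z"
      using * by (intro add_mono mult_left_mono) (auto simp: T_def)
    finally show "u *\<^sub>R y + v *\<^sub>R z \<in> T"
      by (simp add: T_def)
  qed
  moreover have "(x0, p x0 - 1) \<in> S" "(x0, p x0) \<in> T" "S \<inter> T = {}"
    by (auto simp: S_def T_def)
  ultimately obtain w :: "'a \<times> real" and k where "w \<noteq> 0"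
    and S: "\<forall>z\<in>S. w \<bullet> z \<le> k" and T: "\<forall>z\<in>T. k \<le> w \<bullet> z"
    using separating_hyperplane_sets[of S T] by blast
  obtain a b where w: "w = (a, b)" by (cases w)
  have sep: "a \<bullet> x0 + b * s \<le> a \<bullet> x + b * t" if "s < p x0" "p x \<le> t" for x s t
  proof -
    have "(x0, s) \<in> S" "(x, t) \<in> T"
      using that by (simp_all add: S_def T_def)
    then have "w \<bullet> (x0, s) \<le> w \<bullet> (x, t)"
      using S T order_trans by blast
    then show ?thesis by (simp add: w)
  qed
  have "b \<ge> 0"
    using sep[of "p x0 - 1" x0 "p x0"] by (simp add: algebra_simps)
  \<comment> \<open>A vertical hyperplane would give
    \<open>a \<bullet> x0 \<le> a \<bullet> x\<close> for every \<open>x\<close>, since the epigraph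
    projects onto the whole space; \<open>x = x0 - a\<close> then forces
    \<open>a = 0\<close>.\<close>
  moreover have "b \<noteq> 0"
  proof
    assume "b = 0"
    then have "a \<bullet> x0 \<le> a \<bullet> (x0 - a)"
      using sep[of "p x0 - 1" "x0 - a" "p (x0 - a)"] by simp
    then have "a = 0"
      using inner_gt_zero_iff[of a] by (simp add: inner_diff_right not_less[symmetric])
    with \<open>b = 0\<close> \<open>w \<noteq> 0\<close> w show False by (simp add: zero_prod_def)
  qed
  ultimately have b: "b > 0" by simp
  define l where "l = (- 1 / b) *\<^sub>R a"
  have l: "l \<bullet> x = - (a \<bullet> x) / b" for x by (simp add: l_def)
  \<comment> \<open>Letting \<open>s\<close> increase to \<open>p x0\<close> shows that
    \<open>x0\<close> maximises \<open>l \<bullet> x - p x\<close>.\<close>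
  have sub: "l \<bullet> x - p x \<le> l \<bullet> x0 - p x0" for x
  proof -
    have "s \<le> (a \<bullet> x - a \<bullet> x0) / b + p x" if "s < p x0" for s
      using sep[OF that order_refl, of x] b by (simp add: field_simps)
    then have "p x0 \<le> (a \<bullet> x - a \<bullet> x0) / b + p x"
      by (rule dense_le)
    then show ?thesis by (simp add: l diff_divide_distrib)
  qed
  \<comment> \<open>The maximum of a positively homogeneous function is 0: the origin gives one
    inequality, and \<open>2 *\<^sub>R x0\<close>, where the value doubles, gives the other.\<close>
  have "l \<bullet> x0 - p x0 = 0"
    using sub[of 0] sub[of "2 *\<^sub>R x0"] by (simp add: p0 scale)
  moreover from this sub have "l \<bullet> x \<le> p x" for x
    by (metis diff_le_0_iff_le)
  ultimately show ?thesis by (intro that[of l]) auto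
qed

section \<open>Sequences with prescribed averages\<close>

text \<open>Indexing a countable dense subset through \<open>prod_decode\<close> repeats each of its
  points once for every second component of the code, hence arbitrarily late.\<close>

lemma exists_recurrently_dense_sequence:
  fixes M :: "'a::euclidean_space set"
  assumes "M \<noteq> {}"
  obtains q :: "nat \<Rightarrow> 'a" where "range q \<subseteq> M"
    and "\<And>z e n0. z \<in> M \<Longrightarrow> e > 0 \<Longrightarrow> \<exists>k\<ge>n0. dist (q k) z < e"
proof -
  obtain D where D: "countable D" "D \<subseteq> M" "M \<subseteq> closure D"
    using separable by metis
  with assms have ne: "D \<noteq> {}" by auto
  define q where "q k = from_nat_into D (fst (prod_decode k))" for k
  show ?thesis
  proof
    show "range q \<subseteq> M"
      using from_nat_into[OF ne] D(2) by (auto simp: q_def)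
    fix z e and n0 :: nat
    assume "z \<in> M" "(e::real) > 0"
    with D(3) obtain y where y: "y \<in> D" "dist y z < e"
      by (meson closure_approachable subsetD)
    obtain j where j: "from_nat_into D j = y"
      using from_nat_into_surj[OF D(1) y(1)] by auto
    have "q (prod_encode (j, n0)) = y" by (simp add: q_def j)
    with y(2) le_prod_encode_2 show "\<exists>k\<ge>n0. dist (q k) z < e" by metis
  qed
qed

text \<open>Factorial block ends let each block outweigh everything before it: the first
  \<open>fact k\<close> indices are a fraction \<open>1 / Suc k\<close> of
  \<open>fact (Suc k)\<close>, and each of them shifts the sum by at most
  \<open>2 * B\<close>.\<close>

lemma exists_block_sequence:
  fixes q :: "nat \<Rightarrow> 'a::real_normed_vector"
  assumes q: "\<And>k. norm (q k) \<le> B"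
  obtains t :: "nat \<Rightarrow> 'a" where "range t \<subseteq> range q"
    and "\<And>k. norm ((1 / fact (Suc k)) *\<^sub>R (\<Sum>i = 1..fact (Suc k). t i) - q k) \<le> 2 * B / Suc k"
proof -
  \<comment> \<open>On the block \<open>fact k < i \<le> fact (Suc k)\<close> this is
    \<open>q k\<close>. The block for \<open>k = 0\<close> is empty; the indices 0 and 1 both
    receive \<open>q 0\<close>.\<close>
  define t where "t i = q (LEAST k. i \<le> fact (Suc k))" for i :: nat
  have t: "t i = q k" if "fact k < i" "i \<le> fact (Suc k)" for i k
  proof -
    have "(LEAST k. i \<le> fact (Suc k)) = k"
    proof (rule Least_equality)
      fix j assume "i \<le> fact (Suc j)"
      with that(1) have "fact k < (fact (Suc j) :: nat)" by linarith
      then show "k \<le> j"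
        by (metis fact_mono_nat not_less_eq_eq leD)
    qed (use that in simp)
    then show ?thesis by (simp add: t_def)
  qed
  have tB: "norm (t i) \<le> B" for i by (simp add: t_def q)
  show ?thesis
  proof
    show "range t \<subseteq> range q" by (auto simp: t_def)
    fix k
    let ?F = "fact (Suc k) :: nat"
    have le: "fact k \<le> ?F" by (rule fact_mono_nat) simp
    have "(\<Sum>i = 1..?F. t i) - real ?F *\<^sub>R q k = (\<Sum>i = 1..?F. t i - q k)"
      by (simp only: sum_subtractf sum_constant_scaleR) simp
    also have "\<dots> = (\<Sum>i = 1..(fact k::nat). t i - q k)"
      using le by (intro sum.mono_neutral_right) (auto simp: t not_le simp del: fact_Suc)
    finally have "(\<Sum>i = 1..?F. t i) - real ?F *\<^sub>R q k = (\<Sum>i = 1..(fact k::nat). t i - q k)" .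
    moreover have *: "norm (t i - q k) \<le> 2 * B" for i
      using norm_triangle_ineq4[of "t i" "q k"] tB[of i] q[of k] by linarith
    ultimately have "norm ((\<Sum>i = 1..?F. t i) - real ?F *\<^sub>R q k) \<le> (\<Sum>i = 1..(fact k::nat). 2 * B)"
      by (simp only:) (intro sum_norm_le *)
    then have *: "norm ((\<Sum>i = 1..?F. t i) - real ?F *\<^sub>R q k) \<le> fact k * (2 * B)"
      by simp
    have F: "real ?F = real (Suc k) * fact k" by (simp add: distrib_right)
    have "norm ((1 / real ?F) *\<^sub>R (\<Sum>i = 1..?F. t i) - q k)
        = norm ((1 / real ?F) *\<^sub>R ((\<Sum>i = 1..?F. t i) - real ?F *\<^sub>R q k))"
      by (simp add: scaleR_diff_right del: fact_Suc)
    also have "\<dots> = norm ((\<Sum>i = 1..?F. t i) - real ?F *\<^sub>R q k) / real ?F"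
      by (simp del: fact_Suc)
    also have "\<dots> \<le> fact k * (2 * B) / real ?F"
      by (intro divide_right_mono *) simp
    also have "\<dots> = 2 * B / Suc k"
      unfolding F by simp
    finally show "norm ((1 / fact (Suc k)) *\<^sub>R (\<Sum>i = 1..fact (Suc k). t i) - q k) \<le> 2 * B / Suc k"
      by (simp del: fact_Suc)
  qed
qed

text \<open>Keep all discrepancies, target count minus actual count, at least -1 and with sum 0. The
  next target vector raises the sum to 1, so some outcome has positive discrepancy; choosing it
  lowers that one alone, to above -1. Zero sum and the lower bound together bound each discrepancy
  from above.\<close>

lemma exists_sequence_tracking_counts:
  fixes t :: "nat \<Rightarrow> 'w::finite \<Rightarrow> real"
  assumes nonneg: "\<And>i \<omega>. t i \<omega> \<ge> 0" and sum1: "\<And>i. (\<Sum>\<omega>\<in>UNIV. t i \<omega>) = 1"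
  obtains s :: "nat \<Rightarrow> 'w"
  where "\<And>n \<omega>. \<bar>(\<Sum>i = 1..n. t i \<omega>) - (\<Sum>i = 1..n. of_bool (s i = \<omega>))\<bar> \<le> CARD('w)"
proof -
  \<comment> \<open>The state pairs the latest outcome with the discrepancies. The outcome of the
    initial state is arbitrary, because counting starts at index 1.\<close>
  define P :: "nat \<Rightarrow> 'w \<times> ('w \<Rightarrow> real) \<Rightarrow> bool" where
    "P n z \<longleftrightarrow> (\<forall>\<omega>. snd z \<omega> \<ge> -1) \<and> (\<Sum>\<omega>\<in>UNIV. snd z \<omega>) = 0 \<and> (n = 0 \<longrightarrow> snd z = (\<lambda>_. 0))" for n z
  define Q :: "nat \<Rightarrow> 'w \<times> ('w \<Rightarrow> real) \<Rightarrow> 'w \<times> ('w \<Rightarrow> real) \<Rightarrow> bool" where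
    "Q n z z' \<longleftrightarrow> snd z' = (\<lambda>\<omega>. snd z \<omega> + t (Suc n) \<omega> - of_bool (fst z' = \<omega>))" for n z z'
  have "\<exists>z. P 0 z"
    by (rule exI[of _ "(undefined, \<lambda>_. 0)"]) (simp add: P_def)
  moreover have "\<exists>z'. P (Suc n) z' \<and> Q n z z'" if z: "P n z" for n z
  proof -
    define e where "e \<omega> = snd z \<omega> + t (Suc n) \<omega>" for \<omega>
    have e1: "(\<Sum>\<omega>\<in>UNIV. e \<omega>) = 1"
      using z by (simp add: e_def P_def sum.distrib sum1)
    have "\<exists>\<omega>. e \<omega> > 0"
    proof (rule ccontr)
      assume "\<nexists>\<omega>. e \<omega> > 0"
      then have "(\<Sum>\<omega>\<in>UNIV. e \<omega>) \<le> 0" by (intro sum_nonpos) (auto simp: not_less)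
      with e1 show False by simp
    qed
    then obtain \<eta> where \<eta>: "e \<eta> > 0" ..
    have "e \<omega> - of_bool (\<eta> = \<omega>) \<ge> -1" for \<omega>
      using \<eta> z nonneg[of "Suc n" \<omega>] by (cases "\<eta> = \<omega>") (auto simp: e_def P_def add_increasing2)
    moreover have "(\<Sum>\<omega>\<in>UNIV. e \<omega> - of_bool (\<eta> = \<omega>)) = 0"
      by (simp add: sum_subtractf e1)
    ultimately show ?thesis
      by (intro exI[of _ "(\<eta>, \<lambda>\<omega>. e \<omega> - of_bool (\<eta> = \<omega>))"]) (auto simp: P_def Q_def e_def)
  qed
  ultimately obtain f where P: "\<And>n. P n (f n)" and Q: "\<And>n. Q n (f n) (f (Suc n))"
    using dependent_nat_choice[of P Q] by metis
  have f: "snd (f n) \<omega> = (\<Sum>i = 1..n. t i \<omega>) - (\<Sum>i = 1..n. of_bool (fst (f i) = \<omega>))" for n \<omega>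
  proof (induction n)
    case 0
    then show ?case using P[of 0] by (simp add: P_def)
  next
    case (Suc n)
    then show ?case using Q[of n] by (simp add: Q_def)
  qed
  have "\<bar>snd (f n) \<omega>\<bar> \<le> CARD('w)" for n \<omega>
  proof -
    have low: "snd (f n) \<eta> \<ge> -1" for \<eta> using P[of n] by (simp add: P_def)
    have "snd (f n) \<omega> + (\<Sum>\<eta>\<in>UNIV - {\<omega>}. snd (f n) \<eta>) = 0"
      using P[of n] by (simp add: P_def sum.remove[of UNIV \<omega>])
    moreover have "(\<Sum>\<eta>\<in>UNIV - {\<omega>}. snd (f n) \<eta>) \<ge> (\<Sum>\<eta>\<in>UNIV - {\<omega>}. -1)"
      by (intro sum_mono low)
    ultimately have "snd (f n) \<omega> \<le> card (UNIV - {\<omega>})" by simp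
    also have "\<dots> \<le> CARD('w)" by (simp add: card_Diff_subset)
    finally have "snd (f n) \<omega> \<le> CARD('w)" .
    moreover have "real CARD('w) \<ge> 1" by (simp add: Suc_leI)
    ultimately show ?thesis using low[of \<omega>] by linarith
  qed
  then show ?thesis by (intro that[of "\<lambda>i. fst (f i)"]) (simp only: f)
qed

definition frequencies :: "(nat \<Rightarrow> 'w) \<Rightarrow> nat \<Rightarrow> real ^ 'w::finite" where
  "frequencies s n = (\<chi> \<omega>. (1 / real n) * (\<Sum>i = 1..n. of_bool (s i = \<omega>)))"

text \<open>The frequencies follow the running averages of a block sequence, which stay in
  \<open>M\<close> by convexity. The first conclusion later bounds the cluster points from above;
  the second turns every point of \<open>M\<close> into a cluster point.\<close>

lemma exists_sequence_with_limit_frequencies: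
  fixes M :: "(real ^ 'w::finite) set"
  assumes "convex M" "M \<noteq> {}"
    and nonneg: "\<And>p \<omega>. p \<in> M \<Longrightarrow> p $ \<omega> \<ge> 0"
    and sum1: "\<And>p. p \<in> M \<Longrightarrow> (\<Sum>\<omega>\<in>UNIV. p $ \<omega>) = 1"
  obtains s :: "nat \<Rightarrow> 'w" and C :: real
  where "\<And>n. n \<ge> 1 \<Longrightarrow> \<exists>m\<in>M. norm (frequencies s n - m) \<le> C / n"
    and "\<And>z e n0. z \<in> M \<Longrightarrow> e > 0 \<Longrightarrow> \<exists>n\<ge>n0. dist (frequencies s n) z < e"
proof -
  obtain q :: "nat \<Rightarrow> real ^ 'w" where qM: "range q \<subseteq> M"
    and q: "\<And>z e n0. z \<in> M \<Longrightarrow> e > 0 \<Longrightarrow> \<exists>k\<ge>n0. dist (q k) z < e"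
    using exists_recurrently_dense_sequence[OF assms(2)] by metis
  have "norm (q k) \<le> 1" for k
  proof -
    have qk: "q k \<in> M" using qM by auto
    have "norm (q k) \<le> (\<Sum>\<omega>\<in>UNIV. \<bar>q k $ \<omega>\<bar>)" by (rule norm_le_l1_cart)
    also have "\<dots> = 1" using nonneg[OF qk] sum1[OF qk] by simp
    finally show ?thesis .
  qed
  then obtain t :: "nat \<Rightarrow> real ^ 'w" where tq: "range t \<subseteq> range q"
    and t: "\<And>k. norm ((1 / fact (Suc k)) *\<^sub>R (\<Sum>i = 1..fact (Suc k). t i) - q k) \<le> 2 * 1 / Suc k"
    using exists_block_sequence[of q 1] by blast
  have tM: "t i \<in> M" for i using tq qM by blast
  obtain s :: "nat \<Rightarrow> 'w" where
    s: "\<And>n \<omega>. \<bar>(\<Sum>i = 1..n. t i $ \<omega>) - (\<Sum>i = 1..n. of_bool (s i = \<omega>))\<bar> \<le> CARD('w)"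
    using exists_sequence_tracking_counts[of "\<lambda>i \<omega>. t i $ \<omega>"] nonneg[OF tM] sum1[OF tM] by metis
  \<comment> \<open>Each of the \<open>CARD('w)\<close> coordinates deviates by at most
    \<open>CARD('w) / n\<close>, and the Euclidean norm is at most the sum of the absolute
    coordinates.\<close>
  define C where "C = real CARD('w) * real CARD('w)"
  define m where "m n = (1 / real n) *\<^sub>R (\<Sum>i = 1..n. t i)" for n
  have mM: "m n \<in> M" if "n \<ge> 1" for n
    unfolding m_def scaleR_sum_right
    using that by (intro convex_sum assms(1) tM) auto
  have near: "norm (frequencies s n - m n) \<le> C / n" if "n \<ge> 1" for n
  proof -
    have "\<bar>(frequencies s n - m n) $ \<omega>\<bar> \<le> CARD('w) / n" for \<omega>
    proof -
      have "(frequencies s n - m n) $ \<omega>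
          = ((\<Sum>i = 1..n. of_bool (s i = \<omega>)) - (\<Sum>i = 1..n. t i $ \<omega>)) / n"
        by (simp add: frequencies_def m_def diff_divide_distrib)
      then show ?thesis
        using s[where n = n and \<omega> = \<omega>] that by (simp add: divide_right_mono abs_minus_commute)
    qed
    then have "(\<Sum>\<omega>\<in>UNIV. \<bar>(frequencies s n - m n) $ \<omega>\<bar>) \<le> (\<Sum>\<omega>\<in>(UNIV::'w set). CARD('w) / n)"
      by (rule sum_mono)
    also have "\<dots> = C / n" by (simp add: C_def)
    finally show ?thesis
      using norm_le_l1_cart order_trans by blast
  qed
  show ?thesis
  proof
    show "\<exists>m\<in>M. norm (frequencies s n - m) \<le> C / n" if "n \<ge> 1" for n
      using near mM that by blast
    fix z e and n0 :: nat
    assume z: "z \<in> M" and e: "(e::real) > 0"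
    \<comment> \<open>Two errors must stay below \<open>e / 2\<close> together:
      \<open>C / Suc k\<close> between frequencies and averages, and \<open>2 / Suc k\<close> from
      the block estimate with bound 1.\<close>
    obtain k0 :: nat where k0: "2 * (C + 2) / e < k0" using reals_Archimedean2 by blast
    obtain k where k: "k \<ge> max k0 n0" "dist (q k) z < e / 2"
      using q[OF z, of "e / 2"] e half_gt_zero by blast
    \<comment> \<open>The end of block \<open>k\<close>, where the running average is close to
      \<open>q k\<close>.\<close>
    define n :: nat where "n = fact (Suc k)"
    have nk: "Suc k \<le> n" unfolding n_def by (rule fact_ge_self)
    have C: "C \<ge> 0" by (simp add: C_def)
    have "2 * (C + 2) / e < Suc k" using k(1) k0 by linarith
    then have small: "(C + 2) / Suc k < e / 2" using e by (simp add: field_simps)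
    have "norm (frequencies s n - m n) \<le> C / Suc k"
    proof -
      have "C / n \<le> C / Suc k"
        using nk C by (intro divide_left_mono) auto
      with near[of n] nk show ?thesis by linarith
    qed
    moreover have "norm (m n - q k) \<le> 2 / Suc k" using t[of k] by (simp add: m_def n_def del: fact_Suc)
    moreover have "norm (frequencies s n - q k) \<le> norm (frequencies s n - m n) + norm (m n - q k)"
      using norm_triangle_ineq[of "frequencies s n - m n" "m n - q k"] by simp
    ultimately have "norm (frequencies s n - q k) \<le> (C + 2) / Suc k"
      by (simp add: add_divide_distrib)
    then have "dist (frequencies s n) z < e"
      using small k(2) dist_triangle[of "frequencies s n" z "q k"]
      unfolding dist_norm by linarith
    then show "\<exists>n\<ge>n0. dist (frequencies s n) z < e"
      using nk k(1) by (intro exI[of _ n]) auto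
  qed
qed

section \<open>Gambles on a finite space as vectors\<close>

definition vec_of_gamble :: "'w::finite gamble \<Rightarrow> real ^ 'w" where
  "vec_of_gamble X = (\<chi> \<omega>. apply_bcontfun X (discrete \<omega>))"

definition gamble_of_vec :: "real ^ 'w::finite \<Rightarrow> 'w gamble" where
  "gamble_of_vec x = Bcontfun (\<lambda>\<omega>. x $ of_discrete \<omega>)"

lemma apply_gamble_of_vec [simp]: "apply_bcontfun (gamble_of_vec x) \<omega> = x $ of_discrete \<omega>"
proof -
  have "continuous_on UNIV (\<lambda>\<omega>. x $ of_discrete \<omega>)"
    by (simp add: continuous_on_open_vimage open_discrete)
  moreover have "bounded (range (\<lambda>\<omega>. x $ of_discrete \<omega>))"
    by (rule boundedI[of _ "norm x"]) (auto simp: component_le_norm_cart)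
  ultimately show ?thesis
    by (simp add: gamble_of_vec_def bcontfun_def Bcontfun_inverse)
qed

lemma vec_of_gamble_of_vec [simp]: "vec_of_gamble (gamble_of_vec x) = x"
  by (simp add: vec_of_gamble_def discrete_inverse)

lemma gamble_of_vec_of_gamble [simp]: "gamble_of_vec (vec_of_gamble X) = X"
  by (rule bcontfun_eqI) (simp add: vec_of_gamble_def of_discrete_inverse)

lemma gamble_of_vec_add: "gamble_of_vec (x + y) = gamble_of_vec x + gamble_of_vec y"
  by (rule bcontfun_eqI) (simp add: plus_bcontfun.rep_eq)

lemma gamble_of_vec_scaleR: "gamble_of_vec (c *\<^sub>R x) = c *\<^sub>R gamble_of_vec x"
  by (rule bcontfun_eqI) (simp add: scaleR_bcontfun.rep_eq)

section \<open>Linear previsions as vectors, and the weak* topology\<close>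

definition prevision_of_vec :: "real ^ 'w::finite \<Rightarrow> 'w gamble \<Rightarrow>\<^sub>L real" where
  "prevision_of_vec p = Blinfun (\<lambda>X. p \<bullet> vec_of_gamble X)"

lemma apply_prevision_of_vec [simp]:
  "blinfun_apply (prevision_of_vec p) X = p \<bullet> vec_of_gamble X"
proof -
  have "bounded_linear (\<lambda>X. apply_bcontfun X \<omega> :: real)" for \<omega> :: "'a discrete"
    by (rule bounded_linear_intro[where K = 1]) (auto simp: norm_bounded simp flip: real_norm_def)
  then have "bounded_linear (\<lambda>X. \<Sum>\<omega>\<in>UNIV. p $ \<omega> * apply_bcontfun X (discrete \<omega>))"
    by (intro bounded_linear_sum bounded_linear_const_mult)
  then have "bounded_linear (\<lambda>X. p \<bullet> vec_of_gamble X)"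
    by (simp add: inner_vec_def vec_of_gamble_def)
  then show ?thesis
    by (simp only: prevision_of_vec_def bounded_linear_Blinfun_apply)
qed

lemma prevision_of_vec_in_PF:
  assumes "\<And>\<omega>. p $ \<omega> \<ge> 0" "(\<Sum>\<omega>\<in>UNIV. p $ \<omega>) = 1"
  shows "prevision_of_vec p \<in> PF"
  using assms by (auto simp: PF_def inner_vec_def vec_of_gamble_def intro!: sum_nonneg)

text \<open>Continuity is tested at each gamble separately, where the map is an inner product. It
  serves to pull weak* neighbourhoods back to Euclidean balls.\<close>

lemma continuous_map_prevision_of_vec:
  "continuous_map euclidean weak_star_topology prevision_of_vec"
  unfolding weak_star_topology_def continuous_on_strong_operator_topo_iff_coordinatewise
  by (auto intro!: continuous_intros)

text \<open>Group the summands by outcome. At \<open>n = 0\<close> both sides are the zero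
  functional.\<close>

lemma empirical_prevision_eq:
  fixes s :: "nat \<Rightarrow> 'w::finite"
  shows "empirical_prevision s n = prevision_of_vec (frequencies s n)"
proof (rule blinfun_eqI)
  fix X :: "'w gamble"
  have "(\<Sum>\<omega>\<in>UNIV. (\<Sum>i = 1..n. of_bool (s i = \<omega>)) * apply_bcontfun X (discrete \<omega>))
      = (\<Sum>i = 1..n. \<Sum>\<omega>\<in>UNIV. of_bool (s i = \<omega>) * apply_bcontfun X (discrete \<omega>))"
    unfolding sum_distrib_right by (rule sum.swap)
  also have "\<dots> = (\<Sum>i = 1..n. apply_bcontfun X (discrete (s i)))"
    by (simp add: of_bool_def if_distribR if_distrib[of "\<lambda>x. x * _"] cong: if_cong)
  finally show "blinfun_apply (empirical_prevision s n) X
      = blinfun_apply (prevision_of_vec (frequencies s n)) X"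
    by (simp add: inner_vec_def vec_of_gamble_def frequencies_def flip: sum_divide_distrib)
qed

lemma topspace_PF_topology [simp]: "topspace PF_topology = PF"
  by (simp add: PF_topology_def weak_star_topology_def strong_operator_topology_topspace)

text \<open>Supplies the neighbourhoods that test a cluster point on a single gamble.\<close>

lemma openin_PF_evaluation:
  assumes "open U"
  shows "openin PF_topology {E \<in> PF. blinfun_apply E X \<in> U}"
proof -
  have "continuous_map weak_star_topology euclidean (\<lambda>E. blinfun_apply E X)"
    unfolding weak_star_topology_def by (rule strong_operator_topology_continuous_evaluation)
  then have "continuous_map PF_topology euclidean (\<lambda>E. blinfun_apply E X)"
    unfolding PF_topology_def by (rule continuous_map_from_subtopology)
  then show ?thesis
    using openin_continuous_map_preimage[of PF_topology euclidean "\<lambda>E. blinfun_apply E X" U] assms by auto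
qed

section \<open>The credal set of an upper prevision\<close>

definition dominated_vecs :: "('w::finite gamble \<Rightarrow> real) \<Rightarrow> (real ^ 'w) set" where
  "dominated_vecs R = {p. \<forall>X. p \<bullet> vec_of_gamble X \<le> R X}"

lemma convex_dominated_vecs: "convex (dominated_vecs R)"
proof -
  have "dominated_vecs R = (\<Inter>X. {p. vec_of_gamble X \<bullet> p \<le> R X})"
    by (auto simp: dominated_vecs_def inner_commute)
  then show ?thesis by (auto intro: convex_INT convex_halfspace_le)
qed

text \<open>Hahn--Banach carried over to gambles: the upper envelope is a maximum, and in particular
  the credal set is nonempty.\<close>

lemma dominated_vecs_attain:
  assumes "coherent_upper_prevision R"
  obtains p where "p \<in> dominated_vecs R" "p \<bullet> vec_of_gamble X = R X"
proof -
  have "R (gamble_of_vec (c *\<^sub>R x)) = c * R (gamble_of_vec x)" if "c > 0" for c x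
    using assms that by (simp add: coherent_upper_prevision_def gamble_of_vec_scaleR)
  moreover have "R (gamble_of_vec (x + y)) \<le> R (gamble_of_vec x) + R (gamble_of_vec y)" for x y
    using assms by (simp add: coherent_upper_prevision_def gamble_of_vec_add)
  ultimately obtain p where le: "\<And>x. p \<bullet> x \<le> R (gamble_of_vec x)"
    and eq: "p \<bullet> vec_of_gamble X = R (gamble_of_vec (vec_of_gamble X))"
    using sublinear_supporting_functional[of "\<lambda>x. R (gamble_of_vec x)" "vec_of_gamble X"] by metis
  have "p \<bullet> vec_of_gamble Y \<le> R Y" for Y
    using le[of "vec_of_gamble Y"] by simp
  then show ?thesis
    using eq by (intro that[of p]) (simp_all add: dominated_vecs_def)
qed

text \<open>By (UP1), \<open>p \<bullet> x\<close> is at most any upper bound of the coordinates of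
  \<open>x\<close>. Negated unit vectors then give nonnegativity, and the constants 1 and -1 bound
  the total mass from both sides.\<close>

lemma dominated_vecs_probability:
  assumes R: "coherent_upper_prevision R" and p: "p \<in> dominated_vecs R"
  shows "p $ \<omega> \<ge> 0" and "(\<Sum>\<omega>\<in>UNIV. p $ \<omega>) = 1"
proof -
  have le: "p \<bullet> x \<le> b" if "\<And>\<omega>. x $ \<omega> \<le> b" for x b
  proof -
    have "p \<bullet> x \<le> R (gamble_of_vec x)"
      using p unfolding dominated_vecs_def by (metis (mono_tags) mem_Collect_eq vec_of_gamble_of_vec)
    also have "\<dots> \<le> (SUP \<omega>. apply_bcontfun (gamble_of_vec x) \<omega>)"
      using R unfolding coherent_upper_prevision_def by blast
    also have "\<dots> \<le> b"
      by (rule cSUP_least) (auto simp: that)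
    finally show ?thesis .
  qed
  show "p $ \<omega> \<ge> 0"
    using le[of "- axis \<omega> 1" 0] by (simp add: inner_axis) (simp add: axis_def)
  show "(\<Sum>\<omega>\<in>UNIV. p $ \<omega>) = 1"
    using le[of "\<chi> \<omega>. 1" 1] le[of "\<chi> \<omega>. - 1" "- 1"] by (simp add: inner_vec_def sum_negf)
qed

theorem theorem3p1:
  fixes R :: "'w::finite gamble \<Rightarrow> real"
  assumes "coherent_upper_prevision R"
  shows "\<exists>s :: nat \<Rightarrow> 'w. \<forall>X :: 'w gamble.
           ereal (R X) = (SUP E \<in> CP PF_topology (empirical_prevision s). ereal (blinfun_apply E X))"
proof -
  let ?M = "dominated_vecs R"
  note prob = dominated_vecs_probability[OF assms]
  have "?M \<noteq> {}" using dominated_vecs_attain[OF assms] by blast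
  then obtain s :: "nat \<Rightarrow> 'w" and C where
    near: "\<And>n. n \<ge> 1 \<Longrightarrow> \<exists>m\<in>?M. norm (frequencies s n - m) \<le> C / n" and
    cluster: "\<And>z e n0. z \<in> ?M \<Longrightarrow> e > 0 \<Longrightarrow> \<exists>n\<ge>n0. dist (frequencies s n) z < e"
    using exists_sequence_with_limit_frequencies[OF convex_dominated_vecs, of R] prob by metis
  let ?CP = "CP PF_topology (empirical_prevision s)"
  \<comment> \<open>Infinitely often an empirical prevision exceeds \<open>E X - e / 2\<close> at
    \<open>X\<close>, and for large \<open>n\<close> it lies within \<open>e / 2\<close> of a
    functional dominated by \<open>R\<close>.\<close>
  have upper: "blinfun_apply E X \<le> R X" if E: "E \<in> ?CP" for E X
  proof (rule field_le_epsilon)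
    fix e :: real assume e: "e > 0"
    let ?x = "vec_of_gamble X"
    let ?N = "{F \<in> PF. blinfun_apply F X \<in> {blinfun_apply E X - e / 2 <..}}"
    have "E \<in> PF" using E by (simp add: CP_def)
    with e openin_PF_evaluation[of "{blinfun_apply E X - e / 2 <..}" X]
    have "neighbourhood_in PF_topology E ?N"
      by (auto simp: neighbourhood_in_def intro!: exI[of _ ?N])
    moreover obtain n0 :: nat where n0: "2 * C * norm ?x / e < n0" using reals_Archimedean2 by blast
    \<comment> \<open>\<open>Suc n0\<close> makes \<open>n\<close> positive, as \<open>near\<close>
      requires.\<close>
    ultimately obtain n where n: "n \<ge> Suc n0" "empirical_prevision s n \<in> ?N"
      using E unfolding CP_def by blast
    then obtain m where m: "m \<in> ?M" "norm (frequencies s n - m) \<le> C / n"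
      using near[of n] by auto
    have "(frequencies s n - m) \<bullet> ?x \<le> norm (frequencies s n - m) * norm ?x"
      by (rule norm_cauchy_schwarz)
    also have "\<dots> \<le> C / n * norm ?x"
      by (intro mult_right_mono m(2)) simp
    also have "\<dots> < e / 2"
    proof -
      have "2 * C * norm ?x / e < n" using n0 n(1) by linarith
      then show ?thesis using e n(1) by (simp add: field_simps)
    qed
    finally have "frequencies s n \<bullet> ?x < m \<bullet> ?x + e / 2"
      by (simp add: inner_diff_left)
    moreover have "m \<bullet> ?x \<le> R X" using m(1) by (simp add: dominated_vecs_def)
    moreover have "blinfun_apply E X - e / 2 < frequencies s n \<bullet> ?x"
      using n(2) by (simp add: empirical_prevision_eq)
    ultimately show "blinfun_apply E X \<le> R X + e" by linarith
  qed
  \<comment> \<open>A relatively open neighbourhood is the trace on \<open>PF\<close> of a weak*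
    open \<open>U\<close>, whose preimage contains a ball around \<open>p\<close>; the frequencies
    enter that ball arbitrarily late.\<close>
  have mem: "prevision_of_vec p \<in> ?CP" if p: "p \<in> ?M" for p
  proof -
    have "\<exists>n\<ge>n0. empirical_prevision s n \<in> N"
      if N: "neighbourhood_in PF_topology (prevision_of_vec p) N" for N n0
    proof -
      obtain V where V: "openin PF_topology V" "prevision_of_vec p \<in> V" "V \<subseteq> N"
        using N unfolding neighbourhood_in_def by blast
      then obtain U where "openin weak_star_topology U" "V = U \<inter> PF"
        unfolding PF_topology_def openin_subtopology by blast
      with V have U: "openin weak_star_topology U" "prevision_of_vec p \<in> U" "U \<inter> PF \<subseteq> N"
        by auto
      have "open (prevision_of_vec -` U)"
        using openin_continuous_map_preimage[OF continuous_map_prevision_of_vec U(1)]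
        by (simp add: vimage_def)
      then obtain e where e: "e > 0" "\<And>y. dist y p < e \<Longrightarrow> prevision_of_vec y \<in> U"
        using U(2) by (auto simp: open_dist)
      \<comment> \<open>\<open>Suc n0\<close> excludes index 0, where the empirical prevision lies
        outside \<open>PF\<close>.\<close>
      obtain n where n: "n \<ge> Suc n0" "dist (frequencies s n) p < e"
        using cluster[OF p e(1)] by blast
      then have "empirical_prevision s n \<in> U \<inter> PF"
        using e(2) empirical_prevision_in_PF[of n s] by (simp add: empirical_prevision_eq)
      with U(3) n(1) show ?thesis by (intro exI[of _ n]) auto
    qed
    moreover have "prevision_of_vec p \<in> PF"
      using prob[OF p] by (intro prevision_of_vec_in_PF)
    ultimately show ?thesis by (simp add: CP_def)
  qed
  show ?thesis
  \<comment> \<open>Equality in \<open>ereal\<close> with a finite value also says that the set of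
    cluster points is nonempty and its values at \<open>X\<close> are bounded above.\<close>
  proof (intro exI allI antisym)
    fix X :: "'w gamble"
    obtain p where p: "p \<in> ?M" "p \<bullet> vec_of_gamble X = R X"
      using dominated_vecs_attain[OF assms] .
    then show "ereal (R X) \<le> (SUP E \<in> ?CP. ereal (blinfun_apply E X))"
      by (intro SUP_upper2[OF mem[OF p(1)]]) simp
    show "(SUP E \<in> ?CP. ereal (blinfun_apply E X)) \<le> ereal (R X)"
      by (intro SUP_least) (simp add: upper)
  qed
qed

end
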